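(* Let $(X,\mathcal{A},\lambda)$ be a $\sigma$-finite measure space and $T:X\to X$ a null-preserving map, and assume that there is a $T$-invariant probability measure $\mu\ll\lambda$ on $\mathcal{A}$ (i.e. $\mu\circ T^{-1}=\mu$). Then the system $(X,\mathcal{A},\lambda,T)$ is exact if and only if $$A\in\mathcal{A}\ \text{and}\ \lambda(A)>0\quad\text{imply}\quad \mu(\hat{T}^nA)\longrightarrow 1\ \text{ as } n\to\infty .$$ If (in the exact case) $\mu$ is moreover equivalent to $\lambda$ (mutually absolutely continuous) and $\lambda(X)=1$, then also $\lambda(\hat{T}^nA)\to 1$ as $n\to\infty$ for every $A\in\mathcal{A}$ with $\lambda(A)>0$.
   Context: For $A,B\in\mathcal{A}$ write $A\overset{.}{\subseteq}B$ if $\lambda(A\setminus B)=0$ and $A\overset{.}{=}B$ if $\lambda(A\triangle B)=0$. A measurable map $T:X\to X$ is null-preserving if $\lambda(A)=0$ implies $\lambda(T^{-1}A)=0$ for $A\in\mathcal{A}$. An essential image of $A\in\mathcal{A}$ under $T$ is a set $A'\in\mathcal{A}$ such that $T^{-1}A'\overset{.}{\supseteq}A$ and such that every $B'\in\mathcal{A}$ with $T^{-1}B'\overset{.}{\supseteq}A$ satisfies $B'\overset{.}{\supseteq}A'$. In the present ($\sigma$-finite, null-preserving) setting every $A\in\mathcal{A}$ has essential images and they form exactly one equivalence class under $\overset{.}{=}$; $\hat{T}A$ denotes an arbitrary fixed essential image of $A$, and $\hat{T}^n$ is the $n$-fold iterate ($\hat{T}^0A=A$). A tail set is a set $A\in\mathcal{A}$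 with $A\overset{.}{=}B$ for some $B\in\bigcap_{n\ge 0}T^{-n}\mathcal{A}$. The system is exact if every tail set $A$ satisfies $\lambda(A)=0$ or $\lambda(A^c)=0$. *)

theory Defs
  imports "HOL-Probability.Probability"
begin

definition ae_subset :: "'a measure \<Rightarrow> 'a set \<Rightarrow> 'a set \<Rightarrow> bool" where
  "ae_subset M A B \<longleftrightarrow> emeasure M (A - B) = 0"

definition ae_equal :: "'a measure \<Rightarrow> 'a set \<Rightarrow> 'a set \<Rightarrow> bool" where
  "ae_equal M A B \<longleftrightarrow> emeasure M ((A - B) \<union> (B - A)) = 0"

definition null_preserving :: "'a measure \<Rightarrow> ('a \<Rightarrow> 'a) \<Rightarrow> bool" where
  "null_preserving M T \<longleftrightarrow> T \<in> measurable M M \<and>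
     (\<forall>A\<in>sets M. emeasure M A = 0 \<longrightarrow> emeasure M (T -` A \<inter> space M) = 0)"

definition essential_image :: "'a measure \<Rightarrow> ('a \<Rightarrow> 'a) \<Rightarrow> 'a set \<Rightarrow> 'a set \<Rightarrow> bool" where
  "essential_image M T A A' \<longleftrightarrow> A' \<in> sets M \<and> ae_subset M A (T -` A' \<inter> space M) \<and>
     (\<forall>B'\<in>sets M. ae_subset M A (T -` B' \<inter> space M) \<longrightarrow> ae_subset M A' B')"

definition tail_set :: "'a measure \<Rightarrow> ('a \<Rightarrow> 'a) \<Rightarrow> 'a set \<Rightarrow> bool" where
  "tail_set M T A \<longleftrightarrow> A \<in> sets M \<and>
     (\<exists>B\<in>(\<Inter>n. {(T ^^ n) -` C \<inter> space M | C. C \<in> sets M}). ae_equal M A B)"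

definition exact_system :: "'a measure \<Rightarrow> ('a \<Rightarrow> 'a) \<Rightarrow> bool" where
  "exact_system M T \<longleftrightarrow>
     (\<forall>A. tail_set M T A \<longrightarrow> emeasure M A = 0 \<or> emeasure M (space M - A) = 0)"

text \<open>Essential images exist and form exactly one class modulo null sets, so the requirement
  that a function select an essential image of every measurable set is always satisfiable.\<close>

lemma essential_image_exists:
  assumes "sigma_finite_measure M" and np: "null_preserving M T" and A: "A \<in> sets M"
  shows "\<exists>A'. essential_image M T A A'"
proof -
  interpret sigma_finite_measure M by fact
  have T[measurable]: "T \<in> measurable M M"
    using np by (simp add: null_preserving_def)
  obtain h where h[measurable]: "h \<in> borel_measurable M" and hfin: "integral\<^sup>N M h \<noteq> \<infinity>"
    and hpos: "\<And>x. x \<in> space M \<Longrightarrow> 0 < h x"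
    using Ex_finite_integrable_function by auto
  define N where "N = density M h"
  have sN[simp, measurable_cong]: "sets N = sets M" by (simp add: N_def)
  interpret N: finite_measure N
    unfolding N_def using hfin h
    by (intro finite_measureI) (simp cong: nn_integral_cong emeasure_density)
  have null: "emeasure M B = 0" if "B \<in> sets M" "measure N B = 0" for B
  proof -
    have "B \<in> null_sets N"
      using that by (intro null_setsI) (auto simp: N.emeasure_eq_measure)
    then have "AE x in M. x \<in> B \<longrightarrow> h x = 0"
      unfolding N_def by (subst (asm) null_sets_density_iff) auto
    then have "AE x in M. x \<notin> B"
      by (rule AE_mp) (auto intro!: AE_I2 dest: hpos)
    then show ?thesis
      using that by (subst (asm) AE_iff_null_sets[symmetric]) auto
  qed
  define F where "F = {B \<in> sets M. ae_subset M A (T -` B \<inter> space M)}"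
  have F_sets: "B \<in> sets M" if "B \<in> F" for B using that by (simp add: F_def)
  have F_Inter: "(\<Inter>n::nat. B n) \<in> F" if B: "\<And>n. B n \<in> F" for B
  proof -
    have [measurable]: "B n \<in> sets M" for n using B by (rule F_sets)
    have "A - (T -` B n \<inter> space M) \<in> null_sets M" for n
      using B[of n] A by (intro null_setsI) (auto simp: F_def ae_subset_def)
    then have "(\<Union>n. A - (T -` B n \<inter> space M)) \<in> null_sets M"
      by (rule null_sets_UN)
    moreover have "(\<Union>n. A - (T -` B n \<inter> space M)) = A - (T -` (\<Inter>n. B n) \<inter> space M)"
      by auto
    ultimately show ?thesis
      by (auto simp: F_def ae_subset_def null_sets_def)
  qed
  have F_Int: "B \<inter> C \<in> F" if "B \<in> F" "C \<in> F" for B C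
  proof -
    have "(\<Inter>n::nat. if n = 0 then B else C) \<in> F"
      by (rule F_Inter) (use that in auto)
    moreover have "(\<Inter>n::nat. if n = 0 then B else C) = B \<inter> C"
      by (auto split: if_splits)
    ultimately show ?thesis by simp
  qed
  have "T -` space M \<inter> space M = space M"
    using measurable_space[OF T] by auto
  moreover have "emeasure M (A - space M) = 0"
    using sets.sets_into_space[OF A] by (metis Diff_eq_empty_iff emeasure_empty)
  ultimately have spF: "space M \<in> F"
    by (simp add: F_def ae_subset_def)
  define c where "c = Inf (measure N ` F)"
  have bdd: "bdd_below (measure N ` F)"
    by (rule bdd_belowI2[of _ 0]) simp
  have c_le: "c \<le> measure N B" if "B \<in> F" for B
    unfolding c_def using bdd that by (rule cINF_lower)
  have "\<exists>B\<in>F. measure N B < c + 1 / real (Suc n)" for n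
  proof -
    have "Inf (measure N ` F) < c + 1 / real (Suc n)" by (simp add: c_def)
    then show ?thesis using spF bdd by (subst (asm) cINF_less_iff) auto
  qed
  then obtain B where B: "\<And>n. B n \<in> F" "\<And>n. measure N (B n) < c + 1 / real (Suc n)"
    by metis
  define A' where "A' = (\<Inter>n. B n)"
  have A'F: "A' \<in> F" unfolding A'_def by (rule F_Inter) (rule B)
  have A'_le: "measure N A' \<le> c"
  proof (rule field_le_epsilon)
    fix e :: real assume "0 < e"
    then obtain n where n: "1 / real (Suc n) < e" using nat_approx_posE by metis
    have "measure N A' \<le> measure N (B n)"
      using F_sets[OF B(1)] by (intro N.finite_measure_mono) (auto simp: A'_def)
    then show "measure N A' \<le> c + e" using B(2)[of n] n by linarith
  qed
  have "ae_subset M A' C" if "C \<in> F" for C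
  proof -
    have "measure N (A' - C) = measure N A' - measure N (A' \<inter> C)"
      using F_sets[OF A'F] F_sets[OF that] by (intro N.finite_measure_Diff') auto
    then have "measure N (A' - C) \<le> 0"
      using A'_le c_le[OF F_Int[OF A'F that]] by linarith
    then have "measure N (A' - C) = 0"
      using measure_nonneg[of N "A' - C"] by linarith
    then show ?thesis
      unfolding ae_subset_def using F_sets[OF A'F] F_sets[OF that] by (intro null) auto
  qed
  then have "essential_image M T A A'"
    using A'F by (auto simp: essential_image_def F_def)
  then show ?thesis ..
qed

lemma essential_image_iff_ae_equal:
  assumes np: "null_preserving M T" and A: "A \<in> sets M"
    and A': "essential_image M T A A'" and B: "B \<in> sets M"
  shows "essential_image M T A B \<longleftrightarrow> ae_equal M A' B"
proof -
  have T[measurable]: "T \<in> measurable M M"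
    using np by (simp add: null_preserving_def)
  have A's: "A' \<in> sets M" using A' by (simp add: essential_image_def)
  have sub: "ae_subset M C D \<longleftrightarrow> (AE x in M. x \<in> C \<longrightarrow> x \<in> D)"
    if "C \<in> sets M" "D \<in> sets M" for C D
    unfolding ae_subset_def using that
    by (subst AE_iff_measurable[of "C - D"]) (auto dest: sets.sets_into_space)
  have eq: "ae_equal M A' B \<longleftrightarrow> ae_subset M A' B \<and> ae_subset M B A'"
  proof -
    have "(A' - B) \<union> (B - A') \<in> null_sets M \<longleftrightarrow> A' - B \<in> null_sets M \<and> B - A' \<in> null_sets M"
      using A's B null_sets_subset[of "(A' - B) \<union> (B - A')" M "A' - B"]
        null_sets_subset[of "(A' - B) \<union> (B - A')" M "B - A'"]
      by (auto intro: null_sets.Un)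
    then show ?thesis
      using A's B by (simp add: ae_equal_def ae_subset_def null_sets_def)
  qed
  show ?thesis
  proof
    assume "essential_image M T A B"
    then show "ae_equal M A' B"
      using A' unfolding eq essential_image_def by blast
  next
    assume "ae_equal M A' B"
    then have AB: "ae_subset M A' B" and BA: "ae_subset M B A'" by (auto simp: eq)
    have "emeasure M (T -` (A' - B) \<inter> space M) = 0"
      using np AB A's B unfolding null_preserving_def ae_subset_def by blast
    then have "ae_subset M (T -` A' \<inter> space M) (T -` B \<inter> space M)"
      by (simp add: ae_subset_def vimage_Diff Diff_Int_distrib2)
    then have "ae_subset M A (T -` B \<inter> space M)"
      using A' A A's B unfolding essential_image_def by (auto simp: sub)
    moreover have "ae_subset M B C" if "C \<in> sets M" "ae_subset M A (T -` C \<inter> space M)" for C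
    proof -
      have "ae_subset M A' C" using A' that by (simp add: essential_image_def)
      then show ?thesis using BA A's B that(1) by (auto simp: sub)
    qed
    ultimately show "essential_image M T A B"
      using B by (simp add: essential_image_def)
  qed
qed

end

theory Submission
  imports Defs
begin

text \<open>
  Modulo null sets the pullbacks \<open>T\<^sup>-\<^sup>n A\<^sub>n\<close> of the iterated essential images \<open>A\<^sub>n\<close> of \<open>A\<close> increase
  with \<open>n\<close> and start at \<open>A\<close>, and their upper limit is measurable with respect to every
  \<open>T\<^sup>-\<^sup>m \<A>\<close>. In an exact system it therefore has full measure as soon as \<open>A\<close> is not null, and
  invariance gives \<open>\<mu>(A\<^sub>n) = \<mu>(T\<^sup>-\<^sup>n A\<^sub>n) \<rightarrow> 1\<close>. Conversely, if \<open>B = T\<^sup>-\<^sup>n C\<^sub>n\<close> for every \<open>n\<close>, then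
  the \<open>n\<close>-th images of \<open>B\<close> and of its complement are essentially contained in \<open>C\<^sub>n\<close> and in its
  complement, so their \<open>\<mu>\<close>-measures cannot both tend to \<open>1\<close>.
\<close>

section \<open>Convergence of measures of sets\<close>

lemma (in finite_measure) measure_tendsto_AE:
  assumes "\<And>n. A n \<in> sets M" "B \<in> sets M"
    and "AE x in M. \<forall>\<^sub>F n in sequentially. x \<in> A n \<longleftrightarrow> x \<in> B"
  shows "(\<lambda>n. measure M (A n)) \<longlonglongrightarrow> measure M B"
proof -
  have "(\<lambda>n. \<integral>x. indicator (A n) x \<partial>M) \<longlonglongrightarrow> (\<integral>x. indicator B x \<partial>M :: real)"
  proof (rule integral_dominated_convergence)
    show "AE x in M. (\<lambda>n. indicator (A n) x :: real) \<longlonglongrightarrow> indicator B x"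
      using assms(3) by eventually_elim
        (auto intro!: tendsto_eventually elim!: eventually_mono simp: indicator_def)
  qed (use assms in \<open>auto simp: indicator_def intro!: integrable_const[of 1]\<close>)
  then show ?thesis
    using assms(1,2) by simp
qed

lemma (in prob_space) prob_tendsto_1_iff_compl:
  assumes "\<And>n. A n \<in> events"
  shows "(\<lambda>n. prob (A n)) \<longlonglongrightarrow> 1 \<longleftrightarrow> (\<lambda>n. prob (space M - A n)) \<longlonglongrightarrow> 0"
  using tendsto_minus_cancel_left[of "\<lambda>n. prob (A n) - 1" 0 sequentially] assms
  by (simp add: prob_compl LIM_zero_iff)

text \<open>Otherwise sets of summably small \<open>N\<close>-measure would have \<open>M\<close>-measure bounded away from \<open>0\<close>,
  although by Borel--Cantelli almost every point lies in only finitely many of them.\<close>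

lemma absolutely_continuous_measure_tendsto_0:
  assumes "finite_measure N" "finite_measure M" and sets_eq: "sets M = sets N"
    and ac: "absolutely_continuous N M" and B: "\<And>n. B n \<in> sets N"
    and lim: "(\<lambda>n. measure N (B n)) \<longlonglongrightarrow> 0"
  shows "(\<lambda>n. measure M (B n)) \<longlonglongrightarrow> 0"
proof (rule ccontr)
  interpret M: finite_measure M by fact
  interpret N: finite_measure N by fact
  assume "\<not> ?thesis"
  then obtain e where "e > 0" and large: "\<exists>\<^sub>F n in sequentially. e \<le> measure M (B n)"
    by (auto simp: tendsto_iff not_eventually not_less)
  have "\<exists>n. e \<le> measure M (B n) \<and> measure N (B n) < (1/2) ^ k" for k
  proof -
    have "\<forall>\<^sub>F n in sequentially. measure N (B n) < (1/2) ^ k"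
      using lim by (rule order_tendstoD) simp
    from frequently_eventually_conj[OF large this] show ?thesis
      by (auto dest: frequently_ex)
  qed
  then obtain r where r_large: "\<And>k. e \<le> measure M (B (r k))"
    and r_small: "\<And>k. measure N (B (r k)) < (1/2) ^ k"
    by metis
  have "summable (\<lambda>k. measure N (B (r k)))"
    by (rule summable_comparison_test'[OF summable_geometric[of "1/2"]])
      (use r_small in \<open>auto intro: less_imp_le\<close>)
  then have "AE x in N. \<forall>\<^sub>F k in sequentially. x \<in> space N - B (r k)"
    using B by (intro borel_cantelli_AE1) (auto simp: N.emeasure_eq_measure less_top[symmetric])
  then have "AE x in M. \<forall>\<^sub>F k in sequentially. x \<in> B (r k) \<longleftrightarrow> x \<in> {}"
    by (intro absolutely_continuous_AE[OF sets_eq ac]) (auto elim!: eventually_mono)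
  then have "(\<lambda>k. measure M (B (r k))) \<longlonglongrightarrow> measure M {}"
    using B sets_eq by (intro M.measure_tendsto_AE) auto
  then have "e \<le> 0"
    using r_large by (intro LIMSEQ_le_const) auto
  with \<open>e > 0\<close> show False by simp
qed

lemma absolutely_continuous_prob_tendsto_1:
  assumes "prob_space N" "prob_space M" and sets_eq: "sets M = sets N"
    and ac: "absolutely_continuous N M" and B: "\<And>n. B n \<in> sets N"
    and lim: "(\<lambda>n. measure N (B n)) \<longlonglongrightarrow> 1"
  shows "(\<lambda>n. measure M (B n)) \<longlonglongrightarrow> 1"
proof -
  interpret M: prob_space M by fact
  interpret N: prob_space N by fact
  have "(\<lambda>n. measure N (space N - B n)) \<longlonglongrightarrow> 0"
    using lim B by (simp add: N.prob_tendsto_1_iff_compl)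
  then have "(\<lambda>n. measure M (space N - B n)) \<longlonglongrightarrow> 0"
    using B by (intro absolutely_continuous_measure_tendsto_0[OF N.finite_measure_axioms
      M.finite_measure_axioms sets_eq ac]) auto
  then show ?thesis
    using B sets_eq by (simp add: M.prob_tendsto_1_iff_compl sets_eq_imp_space_eq[OF sets_eq])
qed

section \<open>Null-preserving maps and essential images\<close>

lemma emeasure_eq_0_iff_AE:
  "A \<in> sets M \<Longrightarrow> emeasure M A = 0 \<longleftrightarrow> (AE x in M. x \<notin> A)"
  by (auto simp: AE_iff_null_sets[symmetric] null_sets_def)

lemma ae_subset_iff_AE:
  "A \<in> sets M \<Longrightarrow> B \<in> sets M \<Longrightarrow> ae_subset M A B \<longleftrightarrow> (AE x in M. x \<in> A \<longrightarrow> x \<in> B)"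
  by (simp add: ae_subset_def emeasure_eq_0_iff_AE)

lemma ae_equal_iff_AE:
  "A \<in> sets M \<Longrightarrow> B \<in> sets M \<Longrightarrow> ae_equal M A B \<longleftrightarrow> (AE x in M. x \<in> A \<longleftrightarrow> x \<in> B)"
  by (auto simp: ae_equal_def emeasure_eq_0_iff_AE intro!: AE_cong)

lemma null_preserving_measurable: "null_preserving M T \<Longrightarrow> T \<in> measurable M M"
  by (simp add: null_preserving_def)

lemma null_preserving_iff_absolutely_continuous_distr:
  "null_preserving M T \<longleftrightarrow> T \<in> measurable M M \<and> absolutely_continuous M (distr M M T)"
  by (auto simp: null_preserving_def absolutely_continuous_def null_sets_def emeasure_distr)

lemma null_preserving_AE:
  assumes "null_preserving M T" "AE x in M. P x"
  shows "AE x in M. P (T x)"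
proof -
  have T: "T \<in> measurable M M" and ac: "absolutely_continuous M (distr M M T)"
    using assms(1) by (simp_all add: null_preserving_iff_absolutely_continuous_distr)
  have "AE y in distr M M T. P y"
    using ac assms(2) by (rule absolutely_continuous_AE[rotated]) simp
  then show ?thesis
    by (rule AE_distrD[OF T])
qed

lemma null_preserving_comp:
  assumes S: "null_preserving M S" and T: "null_preserving M T"
  shows "null_preserving M (T \<circ> S)"
proof -
  note measurable = S[THEN null_preserving_measurable] T[THEN null_preserving_measurable]
  have "(T \<circ> S) -` A \<inter> space M = S -` (T -` A \<inter> space M) \<inter> space M" for A
    using measurable_space[OF measurable(1)] by auto
  then show ?thesis
    using S T measurable_comp[OF measurable] measurable_sets[OF measurable(2)]
    unfolding null_preserving_def by metis
qed

lemma null_preserving_funpow: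
  assumes "null_preserving M T"
  shows "null_preserving M (T ^^ n)"
proof (induction n)
  case 0
  show ?case by (simp add: null_preserving_def id_def)
next
  case (Suc n)
  then show ?case
    unfolding funpow.simps using assms by (rule null_preserving_comp)
qed

lemma distr_funpow_eq:
  assumes T: "T \<in> measurable M M" and inv: "distr M M T = M"
  shows "distr M M (T ^^ n) = M"
proof (induction n)
  case 0
  show ?case by (simp add: id_def distr_id)
next
  case (Suc n)
  have "distr M M (T ^^ Suc n) = distr (distr M M (T ^^ n)) M T"
    unfolding funpow.simps by (rule distr_distr[symmetric]) (rule T measurable_compose_n[OF T])+
  with Suc inv show ?case by (simp only:)
qed

lemma essential_image_iff_AE:
  assumes T: "T \<in> measurable M M" and A: "A \<in> sets M"
  shows "essential_image M T A A' \<longleftrightarrow> A' \<in> sets M \<and> (AE x in M. x \<in> A \<longrightarrow> T x \<in> A') \<and>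
    (\<forall>B\<in>sets M. (AE x in M. x \<in> A \<longrightarrow> T x \<in> B) \<longrightarrow> (AE x in M. x \<in> A' \<longrightarrow> x \<in> B))"
proof -
  have "ae_subset M A (T -` B \<inter> space M) \<longleftrightarrow> (AE x in M. x \<in> A \<longrightarrow> T x \<in> B)"
    if "B \<in> sets M" for B
    using measurable_sets[OF T that] A
    by (auto simp: ae_subset_iff_AE intro!: AE_cong)
  then show ?thesis
    by (simp add: essential_image_def ae_subset_iff_AE cong: conj_cong)
qed

lemma essential_image_comp:
  assumes S: "null_preserving M S" and T: "T \<in> measurable M M" and A: "A \<in> sets M"
    and AB: "essential_image M S A B" and BC: "essential_image M T B C"
  shows "essential_image M (T \<circ> S) A C"
proof -
  note measurable_S = null_preserving_measurable[OF S]
  have sets: "B \<in> sets M" "C \<in> sets M"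
    using AB BC by (simp_all add: essential_image_def)
  note AB = AB[unfolded essential_image_iff_AE[OF measurable_S A]]
  note BC = BC[unfolded essential_image_iff_AE[OF T sets(1)]]
  have "AE x in M. S x \<in> B \<longrightarrow> T (S x) \<in> C"
    using null_preserving_AE[OF S, of "\<lambda>y. y \<in> B \<longrightarrow> T y \<in> C"] BC by simp
  with AB have "AE x in M. x \<in> A \<longrightarrow> T (S x) \<in> C"
    by (auto elim: AE_mp)
  moreover have "AE x in M. x \<in> C \<longrightarrow> x \<in> D"
    if D: "D \<in> sets M" and AD: "AE x in M. x \<in> A \<longrightarrow> T (S x) \<in> D" for D
  proof -
    have "AE x in M. x \<in> A \<longrightarrow> S x \<in> T -` D \<inter> space M"
      using AD AE_space by eventually_elim (use measurable_space[OF measurable_S] in auto)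
    then have "AE x in M. x \<in> B \<longrightarrow> x \<in> T -` D \<inter> space M"
      using AB measurable_sets[OF T D] by blast
    then have "AE x in M. x \<in> B \<longrightarrow> T x \<in> D"
      by eventually_elim auto
    then show ?thesis
      using BC D by blast
  qed
  ultimately show ?thesis
    using sets by (simp add: essential_image_iff_AE[OF measurable_comp[OF measurable_S T] A])
qed

section \<open>The tail algebra\<close>

definition tail_algebra :: "'a measure \<Rightarrow> ('a \<Rightarrow> 'a) \<Rightarrow> 'a set set" where
  "tail_algebra M T = (\<Inter>n. {(T ^^ n) -` C \<inter> space M | C. C \<in> sets M})"

lemma tail_algebraE:
  assumes "B \<in> tail_algebra M T"
  obtains C where "C \<in> sets M" "B = (T ^^ n) -` C \<inter> space M"
  using INT_D[OF assms[unfolded tail_algebra_def] UNIV_I, of n] by blast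

lemma tail_algebra_subset_sets: "tail_algebra M T \<subseteq> sets M"
  by (auto elim!: tail_algebraE[where n = 0])

lemma limsup_vimage_funpow_in_tail_algebra:
  assumes T: "T \<in> measurable M M" and A: "\<And>n. A n \<in> sets M"
  shows "limsup (\<lambda>n. (T ^^ n) -` A n \<inter> space M) \<in> tail_algebra M T"
  unfolding tail_algebra_def
proof
  fix m
  have Tn: "T ^^ n \<in> measurable M M" for n
    using T by (rule measurable_compose_n)
  define C where "C = limsup (\<lambda>n. (T ^^ n) -` A (n + m) \<inter> space M)"
  have "C \<in> sets M"
    unfolding C_def using A Tn by (intro measurable_limsup measurable_sets)
  moreover have "limsup (\<lambda>n. (T ^^ n) -` A n \<inter> space M) = (T ^^ m) -` C \<inter> space M"
  proof -
    have "limsup (\<lambda>n. (T ^^ n) -` A n \<inter> space M) =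
        limsup (\<lambda>n. (T ^^ (n + m)) -` A (n + m) \<inter> space M)"
      by (rule limsup_shift_k[symmetric])
    also have "\<dots> = (T ^^ m) -` C \<inter> space M"
      using measurable_space[OF Tn[of m]] by (auto simp: C_def mem_limsup_iff funpow_add)
    finally show ?thesis .
  qed
  ultimately show "limsup (\<lambda>n. (T ^^ n) -` A n \<inter> space M)
      \<in> {(T ^^ m) -` C \<inter> space M | C. C \<in> sets M}"
    by blast
qed

lemma tail_set_iff_tail_algebra:
  "tail_set M T A \<longleftrightarrow> A \<in> sets M \<and> (\<exists>B\<in>tail_algebra M T. AE x in M. x \<in> A \<longleftrightarrow> x \<in> B)"
  unfolding tail_set_def tail_algebra_def[symmetric]
  by (intro conj_cong bex_cong refl ae_equal_iff_AE)
    (auto dest: subsetD[OF tail_algebra_subset_sets])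

definition ae_trivial :: "'a measure \<Rightarrow> 'a set \<Rightarrow> bool" where
  "ae_trivial M A \<longleftrightarrow> (AE x in M. x \<notin> A) \<or> (AE x in M. x \<in> A)"

lemma ae_trivial_cong_AE:
  assumes "AE x in M. x \<in> A \<longleftrightarrow> x \<in> B"
  shows "ae_trivial M A \<longleftrightarrow> ae_trivial M B"
proof -
  have "(AE x in M. x \<notin> A) \<longleftrightarrow> (AE x in M. x \<notin> B)" "(AE x in M. x \<in> A) \<longleftrightarrow> (AE x in M. x \<in> B)"
    using assms by (auto elim: eventually_elim2)
  then show ?thesis
    by (simp add: ae_trivial_def)
qed

lemma ae_trivial_iff_emeasure:
  assumes "A \<in> sets M"
  shows "ae_trivial M A \<longleftrightarrow> emeasure M A = 0 \<or> emeasure M (space M - A) = 0"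
proof -
  have "emeasure M (space M - A) = 0 \<longleftrightarrow> (AE x in M. x \<in> A)"
    using assms by (subst emeasure_eq_0_iff_AE) (auto intro: AE_cong)
  with assms show ?thesis
    by (simp add: ae_trivial_def emeasure_eq_0_iff_AE)
qed

lemma exact_system_iff_tail_algebra:
  "exact_system M T \<longleftrightarrow> (\<forall>B\<in>tail_algebra M T. ae_trivial M B)"
proof -
  have "exact_system M T \<longleftrightarrow> (\<forall>A. tail_set M T A \<longrightarrow> ae_trivial M A)"
    by (simp add: exact_system_def tail_set_def ae_trivial_iff_emeasure)
  also have "\<dots> \<longleftrightarrow> (\<forall>B\<in>tail_algebra M T. ae_trivial M B)"
  proof (intro iffI ballI allI impI)
    fix B assume tail_sets_trivial: "\<forall>A. tail_set M T A \<longrightarrow> ae_trivial M A"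
      and B: "B \<in> tail_algebra M T"
    have "B \<in> sets M" using B tail_algebra_subset_sets by (rule rev_subsetD)
    with B have "tail_set M T B"
      unfolding tail_set_iff_tail_algebra by (intro conjI bexI[of _ B]) simp_all
    with tail_sets_trivial show "ae_trivial M B" by simp
  next
    fix A assume tail_algebra_trivial: "\<forall>B\<in>tail_algebra M T. ae_trivial M B"
      and "tail_set M T A"
    then obtain B where "B \<in> tail_algebra M T" and AB: "AE x in M. x \<in> A \<longleftrightarrow> x \<in> B"
      unfolding tail_set_iff_tail_algebra by (elim conjE bexE)
    with tail_algebra_trivial show "ae_trivial M A"
      by (simp add: ae_trivial_cong_AE[OF AB])
  qed
  finally show ?thesis .
qed

section \<open>Iterated essential images\<close>

locale essential_image_operator =
  fixes M :: "'a measure" and T :: "'a \<Rightarrow> 'a" and F :: "'a set \<Rightarrow> 'a set"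
  assumes null_preserving: "null_preserving M T"
    and essential_image: "A \<in> sets M \<Longrightarrow> essential_image M T A (F A)"
begin

lemmas measurable_T = null_preserving_measurable[OF null_preserving]

lemma essential_image_funpow:
  assumes A: "A \<in> sets M"
  shows "essential_image M (T ^^ n) A ((F ^^ n) A)"
proof (induction n)
  case 0
  have "id \<in> measurable M M" by (simp add: id_def)
  with A show ?case by (simp add: essential_image_iff_AE)
next
  case (Suc n)
  then have "(F ^^ n) A \<in> sets M"
    by (simp add: essential_image_def)
  then have "essential_image M T ((F ^^ n) A) ((F ^^ Suc n) A)"
    by (simp add: essential_image)
  with null_preserving_funpow[OF null_preserving] measurable_T A Suc
  have "essential_image M (T \<circ> T ^^ n) A ((F ^^ Suc n) A)"
    by (rule essential_image_comp)
  then show ?case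
    by (simp only: funpow.simps)
qed

lemma funpow_image_sets: "A \<in> sets M \<Longrightarrow> (F ^^ n) A \<in> sets M"
  using essential_image_funpow by (simp add: essential_image_def)

lemma AE_in_funpow_image_mono:
  assumes A: "A \<in> sets M"
  shows "AE x in M. mono (\<lambda>n. (T ^^ n) x \<in> (F ^^ n) A)"
proof -
  have "AE x in M. x \<in> (F ^^ n) A \<longrightarrow> T x \<in> (F ^^ Suc n) A" for n
    using essential_image[OF funpow_image_sets[OF A]] funpow_image_sets[OF A]
    by (simp add: essential_image_iff_AE[OF measurable_T])
  then have "AE x in M. (T ^^ n) x \<in> (F ^^ n) A \<longrightarrow> T ((T ^^ n) x) \<in> (F ^^ Suc n) A" for n
    by (rule null_preserving_AE[OF null_preserving_funpow[OF null_preserving]])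
  then have "AE x in M. \<forall>n. (T ^^ n) x \<in> (F ^^ n) A \<longrightarrow> (T ^^ Suc n) x \<in> (F ^^ Suc n) A"
    by (simp add: AE_all_countable)
  then show ?thesis
    by (simp add: mono_iff_le_Suc le_bool_def)
qed

lemma exact_system_AE_frequently_in_funpow_image:
  assumes exact: "exact_system M T" and A: "A \<in> sets M" "emeasure M A > 0"
  shows "AE x in M. \<exists>\<^sub>F n in sequentially. (T ^^ n) x \<in> (F ^^ n) A"
proof -
  define L where "L = limsup (\<lambda>n. (T ^^ n) -` ((F ^^ n) A) \<inter> space M)"
  have "L \<in> tail_algebra M T"
    unfolding L_def using measurable_T funpow_image_sets[OF A(1)]
    by (rule limsup_vimage_funpow_in_tail_algebra)
  then have L_trivial: "ae_trivial M L"
    using exact by (simp add: exact_system_iff_tail_algebra)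
  have A_subset_L: "AE x in M. x \<in> A \<longrightarrow> x \<in> L"
    using AE_in_funpow_image_mono[OF A(1)] AE_space
  proof eventually_elim
    case (elim x)
    have "(T ^^ n) x \<in> (F ^^ n) A" if "x \<in> A" for n
      using monoD[OF elim(1), of 0 n] that by simp
    with elim(2) show ?case by (simp add: L_def mem_limsup_iff)
  qed
  have "\<not> (AE x in M. x \<notin> L)"
  proof
    assume "AE x in M. x \<notin> L"
    with A_subset_L have "AE x in M. x \<notin> A" by eventually_elim auto
    with A show False by (simp add: emeasure_eq_0_iff_AE[symmetric])
  qed
  with L_trivial have "AE x in M. x \<in> L" by (simp add: ae_trivial_def)
  then show ?thesis
    by eventually_elim (auto simp: L_def mem_limsup_iff elim: frequently_elim1)
qed

lemma exact_system_AE_eventually_in_funpow_image: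
  assumes exact: "exact_system M T" and A: "A \<in> sets M" "emeasure M A > 0"
  shows "AE x in M. \<forall>\<^sub>F n in sequentially. (T ^^ n) x \<in> (F ^^ n) A"
  using exact_system_AE_frequently_in_funpow_image[OF exact A] AE_in_funpow_image_mono[OF A(1)]
proof eventually_elim
  case (elim x)
  then obtain k where "(T ^^ k) x \<in> (F ^^ k) A"
    by (auto dest: frequently_ex)
  with monoD[OF elim(2)] show ?case
    by (auto simp: eventually_sequentially le_bool_def)
qed

lemma tail_algebra_AE_disjoint_funpow_images:
  assumes B: "B \<in> tail_algebra M T"
  shows "AE x in M. x \<notin> (F ^^ n) B \<or> x \<notin> (F ^^ n) (space M - B)"
proof -
  obtain C where C: "C \<in> sets M" and BC: "B = (T ^^ n) -` C \<inter> space M"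
    using B by (rule tail_algebraE)
  have Tn: "T ^^ n \<in> measurable M M"
    using measurable_T by (rule measurable_compose_n)
  have image_least: "AE x in M. x \<in> (F ^^ n) A \<longrightarrow> x \<in> D"
    if "A \<in> sets M" "D \<in> sets M" "AE x in M. x \<in> A \<longrightarrow> (T ^^ n) x \<in> D" for A D
    using essential_image_funpow[OF that(1), of n, unfolded essential_image_iff_AE[OF Tn that(1)]]
      that(2,3) by blast
  have "B \<in> sets M" using B tail_algebra_subset_sets by blast
  then have "AE x in M. x \<in> (F ^^ n) B \<longrightarrow> x \<in> C"
    using C by (intro image_least) (auto simp: BC)
  moreover have "AE x in M. x \<in> (F ^^ n) (space M - B) \<longrightarrow> x \<in> space M - C"
    using \<open>B \<in> sets M\<close> C measurable_space[OF Tn]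
    by (intro image_least) (auto simp: BC)
  ultimately show ?thesis
    by eventually_elim auto
qed

lemma exact_system_imp_measure_funpow_image_tendsto_1:
  assumes "prob_space \<mu>" and sets_eq: "sets \<mu> = sets M" and ac: "absolutely_continuous M \<mu>"
    and inv: "distr \<mu> \<mu> T = \<mu>"
    and exact: "exact_system M T" and A: "A \<in> sets M" "emeasure M A > 0"
  shows "(\<lambda>n. measure \<mu> ((F ^^ n) A)) \<longlonglongrightarrow> 1"
proof -
  interpret prob_space \<mu> by fact
  have T: "T \<in> measurable \<mu> \<mu>"
    using measurable_T by (simp add: sets_eq cong: measurable_cong_sets)
  have image_events: "(F ^^ n) A \<in> events" for n
    using funpow_image_sets[OF A(1)] sets_eq by simp
  define P where "P n = (T ^^ n) -` ((F ^^ n) A) \<inter> space \<mu>" for n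
  have P_events: "P n \<in> events" for n
    unfolding P_def using measurable_compose_n[OF T] image_events by (rule measurable_sets)
  have "AE x in \<mu>. \<forall>\<^sub>F n in sequentially. (T ^^ n) x \<in> (F ^^ n) A"
    using exact_system_AE_eventually_in_funpow_image[OF exact A]
    by (rule absolutely_continuous_AE[OF sets_eq ac])
  then have "AE x in \<mu>. \<forall>\<^sub>F n in sequentially. x \<in> P n \<longleftrightarrow> x \<in> space \<mu>"
    using AE_space by eventually_elim (auto simp: P_def elim: eventually_mono)
  then have "(\<lambda>n. prob (P n)) \<longlonglongrightarrow> prob (space \<mu>)"
    using P_events by (intro measure_tendsto_AE) auto
  moreover have "prob (P n) = prob ((F ^^ n) A)" for n
    using measure_distr[OF measurable_compose_n[OF T] image_events]
    by (simp add: P_def distr_funpow_eq[OF T inv])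
  ultimately show ?thesis
    by (simp add: prob_space)
qed

lemma exact_system_if_measure_funpow_image_tendsto_1:
  assumes "prob_space \<mu>" and sets_eq: "sets \<mu> = sets M" and ac: "absolutely_continuous M \<mu>"
    and lim: "\<And>A. A \<in> sets M \<Longrightarrow> emeasure M A > 0 \<Longrightarrow> (\<lambda>n. measure \<mu> ((F ^^ n) A)) \<longlonglongrightarrow> 1"
  shows "exact_system M T"
  unfolding exact_system_iff_tail_algebra
proof (intro ballI, rule ccontr)
  interpret prob_space \<mu> by fact
  fix B assume B: "B \<in> tail_algebra M T" and nontrivial: "\<not> ae_trivial M B"
  let ?B' = "space M - B"
  have B_sets: "B \<in> sets M" "?B' \<in> sets M"
    using B tail_algebra_subset_sets by blast+
  have images: "(F ^^ n) B \<in> events" "(F ^^ n) ?B' \<in> events" for n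
    using B_sets funpow_image_sets sets_eq by auto
  have sum_le: "prob ((F ^^ n) B) + prob ((F ^^ n) ?B') \<le> 1" for n
  proof -
    have "AE x in \<mu>. x \<notin> (F ^^ n) B \<or> x \<notin> (F ^^ n) ?B'"
      using tail_algebra_AE_disjoint_funpow_images[OF B]
      by (rule absolutely_continuous_AE[OF sets_eq ac])
    then have "prob ((F ^^ n) B \<union> (F ^^ n) ?B') = prob ((F ^^ n) B) + prob ((F ^^ n) ?B')"
      using images by (intro measure_Un_AE) (auto simp: fmeasurable_eq_sets)
    then show ?thesis
      using prob_le_1[of "(F ^^ n) B \<union> (F ^^ n) ?B'"] by linarith
  qed
  have "emeasure M B > 0" "emeasure M ?B' > 0"
    using nontrivial B_sets
    by (simp_all add: zero_less_iff_neq_zero ae_trivial_iff_emeasure)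
  then have "(\<lambda>n. prob ((F ^^ n) B) + prob ((F ^^ n) ?B')) \<longlonglongrightarrow> 1 + 1"
    using B_sets by (intro tendsto_add lim)
  then have "(1 + 1 :: real) \<le> 1"
    by (rule LIMSEQ_le_const2) (use sum_le in auto)
  then show False by simp
qed

end

theorem theorem5p6:
  fixes M \<mu> :: "'a measure" and T :: "'a \<Rightarrow> 'a" and That :: "'a set \<Rightarrow> 'a set"
  assumes "sigma_finite_measure M"
    and "null_preserving M T"
    and "prob_space \<mu>" and "sets \<mu> = sets M"
    and "absolutely_continuous M \<mu>"
    and "distr \<mu> \<mu> T = \<mu>"
    and "\<forall>A\<in>sets M. essential_image M T A (That A)"
  shows "(exact_system M T \<longleftrightarrow>
            (\<forall>A\<in>sets M. emeasure M A > 0 \<longrightarrow> (\<lambda>n. measure \<mu> ((That ^^ n) A)) \<longlonglongrightarrow> 1)) \<and>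
         (exact_system M T \<and> absolutely_continuous \<mu> M \<and> emeasure M (space M) = 1 \<longrightarrow>
            (\<forall>A\<in>sets M. emeasure M A > 0 \<longrightarrow> (\<lambda>n. measure M ((That ^^ n) A)) \<longlonglongrightarrow> 1))"
proof -
  interpret essential_image_operator M T That
    using assms(2,7) by unfold_locales auto
  note images_tendsto = exact_system_imp_measure_funpow_image_tendsto_1[OF assms(3-6)]
  have "(\<lambda>n. measure M ((That ^^ n) A)) \<longlonglongrightarrow> 1"
    if "exact_system M T" "absolutely_continuous \<mu> M" "emeasure M (space M) = 1"
      and A: "A \<in> sets M" "emeasure M A > 0" for A
  proof (rule absolutely_continuous_prob_tendsto_1[where N = \<mu>])
    show "prob_space M" using that(3) by (rule prob_spaceI)
    show "(\<lambda>n. measure \<mu> ((That ^^ n) A)) \<longlonglongrightarrow> 1" by (rule images_tendsto) fact+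
    show "(That ^^ n) A \<in> sets \<mu>" for n using funpow_image_sets[OF A(1)] assms(4) by simp
  qed (simp_all add: assms(3,4) that(2))
  then show ?thesis
    using images_tendsto exact_system_if_measure_funpow_image_tendsto_1[OF assms(3-5)] by blast
qed

end
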